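(* For every $n\ge1$, the map $\vartheta$ is a bijection from $\mathfrak{G}^{\mathrm{I}}_{2n}$ to $\mathfrak{D}_{2n}$, and for every $\pi\in\mathfrak{G}^{\mathrm{I}}_{2n}$ with $\sigma=\vartheta(\pi)$ one has $\mathrm{Lrmin}(\pi)=\mathrm{Cmin}(\sigma)$.
   Context: $\mathfrak{G}^{\mathrm{I}}_{2n}$ is the set of permutations $\pi=\pi_1\cdots\pi_{2n}$ of $[2n]$ such that every ascent $\pi_i<\pi_{i+1}$ has $\pi_i$ odd and $\pi_{i+1}$ even. $\mathfrak{D}_{2n}$ is the set of permutations $\sigma$ of $[2n]$ with $\sigma_{2i}\le2i$ and $\sigma_{2i-1}\ge2i-1$ for all $i\in[n]$. $\mathrm{Lrmin}(\pi)$ is the set of left-to-right minima of $\pi$ (entries smaller than all entries to their left, including $\pi_1$); $\mathrm{Cmin}(\sigma)$ is the set of smallest elements of the cycles of $\sigma$. In a cycle $(c_1\,\cdots\,c_k)$, an element $c_i$ is an even cyclic double ascent if $c_{i-1}<c_i<c_{i+1}$ (indices cyclic, $c_{k+1}=c_1$, $c_0=c_k$) and $c_i$ is even. The map $\vartheta$ is defined in two steps: (1) split the one-line notation of $\pi$ into blocks, starting a new block at each left-to-right minimum, regard each block $c_1c_2\cdots c_k$ as a cycle and replace it by $(c_1\,c_k\,c_{k-1}\cdots c_2)$; the resulting cycle notation defines a permutation $\hat\pi$. (2) Inside each cycle of $\hat\pi$, shift each even cyclic double ascent to the right (cyclically, past its successors) until it is larger than its successor; the resulting cycle notation defines $\sigma=\vartheta(\pi)$.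 *)

theory Defs
  imports "HOL-Combinatorics.Cycles" "HOL-Combinatorics.Orbits"
begin

text \<open>
  A permutation of \<open>[m] = {1..m}\<close> is a function \<open>p :: nat \<Rightarrow> nat\<close> with \<open>p permutes {1..m}\<close>;
  its one-line notation is \<open>p 1, ..., p m\<close>.
\<close>

definition GI :: "nat \<Rightarrow> (nat \<Rightarrow> nat) set" where
  "GI n = {p. p permutes {1..2*n} \<and>
     (\<forall>i\<in>{1..<2*n}. p i < p (i + 1) \<longrightarrow> odd (p i) \<and> even (p (i + 1)))}"

definition DD :: "nat \<Rightarrow> (nat \<Rightarrow> nat) set" where
  "DD n = {s. s permutes {1..2*n} \<and>
     (\<forall>i\<in>{1..n}. s (2*i) \<le> 2*i \<and> s (2*i - 1) \<ge> 2*i - 1)}"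

definition Lrmin :: "nat \<Rightarrow> (nat \<Rightarrow> nat) \<Rightarrow> nat set" where
  "Lrmin m p = {p i | i. i \<in> {1..m} \<and> (\<forall>j\<in>{1..<i}. p i < p j)}"

text \<open>Fixed points in \<open>[m]\<close> are cycles as well.\<close>

definition Cmin :: "nat \<Rightarrow> (nat \<Rightarrow> nat) \<Rightarrow> nat set" where
  "Cmin m s = {Min C | C. C \<in> orbit s ` {1..m}}"

definition one_line :: "nat \<Rightarrow> (nat \<Rightarrow> nat) \<Rightarrow> nat list" where
  "one_line m p = map p [1..<m+1]"

text \<open>Split a word into blocks, starting a new block at each letter that lies in \<open>M\<close>.\<close>

function split_at :: "nat set \<Rightarrow> nat list \<Rightarrow> nat list list" where
  "split_at M [] = []"
| "split_at M (x # xs) =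
     (x # takeWhile (\<lambda>y. y \<notin> M) xs) # split_at M (dropWhile (\<lambda>y. y \<notin> M) xs)"
  by pat_completeness auto
termination
  by (relation "measure (\<lambda>(M, xs). length xs)") (auto simp: less_Suc_eq_le length_dropWhile_le)

text \<open>The block \<open>c\<^sub>1 c\<^sub>2 ... c\<^sub>k\<close> becomes the cycle \<open>(c\<^sub>1 c\<^sub>k ... c\<^sub>2)\<close>.\<close>

fun flip_block :: "nat list \<Rightarrow> nat list" where
  "flip_block [] = []"
| "flip_block (c # cs) = c # rev cs"

definition hat_cycles :: "nat \<Rightarrow> (nat \<Rightarrow> nat) \<Rightarrow> nat list list" where
  "hat_cycles m p = map flip_block (split_at (Lrmin m p) (one_line m p))"

text \<open>
  The even cyclic double ascents of the cycle \<open>(c ! 0 ... c ! (k-1))\<close>, in the order in which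
  they are written; predecessor and successor are taken modulo \<open>k\<close>.
\<close>

definition even_cdasc :: "nat list \<Rightarrow> nat list" where
  "even_cdasc c = (let k = length c in
     map ((!) c) (filter (\<lambda>i. even (c ! i) \<and>
        c ! ((i + k - 1) mod k) < c ! i \<and> c ! i < c ! ((i + 1) mod k)) [0..<k]))"

text \<open>
  Shift \<open>x\<close> to the right in the cycle \<open>c\<close>, past every successor that is larger than \<open>x\<close>, until its
  successor is smaller. The cycle is first rotated so that it is written starting with \<open>x\<close>; its
  other elements then follow \<open>x\<close> in cyclic order.
\<close>

definition rotate_to :: "nat \<Rightarrow> nat list \<Rightarrow> nat list" where
  "rotate_to x c = dropWhile (\<lambda>y. y \<noteq> x) c @ takeWhile (\<lambda>y. y \<noteq> x) c"

definition shift_right :: "nat \<Rightarrow> nat list \<Rightarrow> nat list" where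
  "shift_right x c = (let ys = tl (rotate_to x c)
     in takeWhile (\<lambda>y. x < y) ys @ x # dropWhile (\<lambda>y. x < y) ys)"

text \<open>
  The elements to be shifted are determined once, from the given cycle, and are then shifted one
  after the other. For the cycles arising from \<open>GI n\<close> the order of the shifts is immaterial;
  the order of writing is used.
\<close>

definition shift_cycle :: "nat list \<Rightarrow> nat list" where
  "shift_cycle c = fold shift_right (even_cdasc c) c"

text \<open>
  The permutation with the given cycle notation; \<^const>\<open>cycle_of_list\<close> maps each
  entry of a list to the next one and the last entry to the first.
\<close>

definition perm_of_cycles :: "nat list list \<Rightarrow> nat \<Rightarrow> nat" where
  "perm_of_cycles cs = foldr (\<lambda>c s. cycle_of_list c \<circ> s) cs id"

definition theta :: "nat \<Rightarrow> (nat \<Rightarrow> nat) \<Rightarrow> (nat \<Rightarrow> nat)" where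
  "theta n p = perm_of_cycles (map shift_cycle (hat_cycles (2*n) p))"

end

theory Submission
  imports Defs "HOL-Combinatorics.Multiset_Permutations"
begin

text \<open>
  Write a permutation canonically as a product of cycles, each starting with its minimum, with the
  minima decreasing. Erasing the parentheses is Foata's bijection from permutations to words, and
  the cycles are recovered by cutting at the left-to-right minima. So it suffices to treat a single
  cycle \<open>m w\<close> with minimum \<open>m\<close>, and to see that the shifts act bijectively on \<open>w\<close>.

  Split \<open>w = u k v\<close> at its least letter \<open>k\<close>. No letter of \<open>u\<close> or \<open>v\<close> is shifted past \<open>k\<close> or past an end
  of \<open>w\<close>, while \<open>k\<close>, if shifted, moves past all of \<open>v\<close>. The shifts therefore commute with the
  splitting: \<open>hop (u k v) = hop u k hop v\<close> if \<open>k\<close> stays, which for the words in question means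
  that \<open>k\<close> is odd, and \<open>hop (k v) = hop v k\<close> if \<open>k\<close> is even. The conditions defining both sides of
  the bijection split in the same way, so bijectivity follows by induction. The two bijections
  between words, cycle notations and permutations need only be shown injective, by counting.
\<close>

section \<open>Valley hopping on words\<close>

text \<open>This is structural induction on the increasing binary tree of a word with distinct
  letters: the least letter \<open>k\<close> is the root, \<open>u\<close> and \<open>v\<close> are
  its subtrees.\<close>

lemma min_split_induct [consumes 1, case_names Nil split]:
  fixes w :: "nat list"
  assumes "distinct w"
    and "P []"
    and "\<And>u k v. distinct (u @ k # v) \<Longrightarrow> (\<forall>y\<in>set u \<union> set v. k < y) \<Longrightarrow> P u \<Longrightarrow> P v \<Longrightarrow> P (u @ k # v)"
  shows "P w"
  using assms(1)
proof (induction w rule: length_induct)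
  case (1 w)
  show ?case
  proof (cases "w = []")
    case True
    then show ?thesis using assms(2) by simp
  next
    case False
    define k where "k = Min (set w)"
    have "k \<in> set w" using False by (simp add: k_def)
    then obtain u v where w: "w = u @ k # v" by (meson split_list)
    have "k < y" if "y \<in> set u \<union> set v" for y
    proof -
      have "k \<le> y" unfolding k_def using that w by (intro Min_le) auto
      moreover have "k \<noteq> y" using that 1(2) w by auto
      ultimately show ?thesis by simp
    qed
    moreover have "P u" "P v" using 1 w by auto
    ultimately show ?thesis using assms(3) 1(2) w by blast
  qed
qed

text \<open>The non-cyclic form of \<open>shift_right\<close>: the end of the word stops
  \<open>x\<close>, just as the minimum at the head of the cycle does.\<close>

definition linear_shift :: "nat \<Rightarrow> nat list \<Rightarrow> nat list" where
  "linear_shift x w = (let ys = tl (dropWhile (\<lambda>y. y \<noteq> x) w)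
     in takeWhile (\<lambda>y. y \<noteq> x) w @ takeWhile (\<lambda>y. x < y) ys @ x # dropWhile (\<lambda>y. x < y) ys)"

lemma linear_shift_eq:
  "x \<notin> set u \<Longrightarrow> linear_shift x (u @ x # v)
     = u @ takeWhile (\<lambda>y. x < y) v @ x # dropWhile (\<lambda>y. x < y) v"
  by (induction u) (auto simp: linear_shift_def Let_def)

lemma set_linear_shift: "x \<in> set w \<Longrightarrow> set (linear_shift x w) = set w"
proof -
  assume "x \<in> set w"
  then obtain u v where w: "w = u @ x # v" "x \<notin> set u" by (meson split_list_first)
  have "set (takeWhile (\<lambda>y. x < y) v) \<union> set (dropWhile (\<lambda>y. x < y) v) = set v"
    by (metis set_append takeWhile_dropWhile_id)
  then show ?thesis using w by (auto simp: linear_shift_eq)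
qed

lemma distinct_linear_shift:
  assumes "distinct w" "x \<in> set w"
  shows "distinct (linear_shift x w)"
proof -
  obtain u v where w: "w = u @ x # v" "x \<notin> set u"
    using assms(2) by (meson split_list_first)
  have "mset (linear_shift x w) = mset w"
    using w by (simp add: linear_shift_eq) (metis mset_append takeWhile_dropWhile_id)
  then show ?thesis
    using assms(1) by (metis mset_eq_imp_distinct_iff)
qed

text \<open>The smaller letter \<open>k\<close> is a wall that \<open>x\<close> cannot pass, so
  nothing from \<open>k\<close> onwards is touched.\<close>

lemma linear_shift_append_left:
  assumes "x \<in> set u" "k < x"
  shows "linear_shift x (u @ k # v) = linear_shift x u @ k # v"
proof -
  obtain a b where u: "u = a @ x # b" "x \<notin> set a" using assms(1) by (meson split_list_first)
  have "takeWhile (\<lambda>y. x < y) (b @ k # v) = takeWhile (\<lambda>y. x < y) b"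
    "dropWhile (\<lambda>y. x < y) (b @ k # v) = dropWhile (\<lambda>y. x < y) b @ k # v"
    using assms(2) by (induction b) auto
  then show ?thesis using u by (simp add: linear_shift_eq)
qed

lemma linear_shift_append_right:
  assumes "x \<notin> set u" "x \<in> set v"
  shows "linear_shift x (u @ v) = u @ linear_shift x v"
proof -
  obtain a b where v: "v = a @ x # b" "x \<notin> set a" using assms(2) by (meson split_list_first)
  then have "linear_shift x ((u @ a) @ x # b) = u @ linear_shift x v"
    using assms(1) by (simp add: linear_shift_eq del: append_assoc)
  then show ?thesis using v by simp
qed

lemma fold_linear_shift_set:
  "set es \<subseteq> set w \<Longrightarrow> set (fold linear_shift es w) = set w"
  by (induction es arbitrary: w) (auto simp: set_linear_shift)

lemma fold_linear_shift_distinct: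
  "set es \<subseteq> set w \<Longrightarrow> distinct w \<Longrightarrow> distinct (fold linear_shift es w)"
  by (induction es arbitrary: w) (auto simp: set_linear_shift distinct_linear_shift)

lemma fold_linear_shift_append_left:
  "set es \<subseteq> set u \<Longrightarrow> \<forall>x\<in>set es. k < x \<Longrightarrow>
     fold linear_shift es (u @ k # v) = fold linear_shift es u @ k # v"
  by (induction es arbitrary: u) (auto simp: set_linear_shift linear_shift_append_left)

lemma fold_linear_shift_append_right:
  "set es \<subseteq> set v \<Longrightarrow> set es \<inter> set u = {} \<Longrightarrow>
     fold linear_shift es (u @ v) = u @ fold linear_shift es v"
  by (induction es arbitrary: v) (auto simp: set_linear_shift linear_shift_append_right)

text \<open>The boundary letters \<open>a\<close> and \<open>b\<close> stand for the neighbours of the word inside its cycle.\<close>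

fun even_dasc :: "nat \<Rightarrow> nat list \<Rightarrow> nat \<Rightarrow> nat list" where
  "even_dasc a [] b = []"
| "even_dasc a (y # ys) b =
     (if even y \<and> a < y \<and> y < hd (ys @ [b]) then [y] else []) @ even_dasc y ys b"

lemma set_even_dasc: "set (even_dasc a w b) \<subseteq> set w"
  by (induction w arbitrary: a) auto

text \<open>Cutting creates new boundaries: \<open>k\<close> is the right neighbour of
  \<open>u\<close>, and \<open>last (a # u)\<close>, which is \<open>a\<close> for empty
  \<open>u\<close>, is the left neighbour of \<open>k\<close>.\<close>

lemma even_dasc_append:
  "even_dasc a (u @ k # v) b = even_dasc a u k @ even_dasc (last (a # u)) (k # v) b"
  by (induction u arbitrary: a) (auto simp: hd_append)

lemma even_dasc_right_cong:
  "\<forall>y\<in>set w. b < y \<and> b' < y \<Longrightarrow> even_dasc a w b = even_dasc a w b'"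
  by (induction w arbitrary: a) (auto simp: hd_append)

text \<open>Boundary letters enter only through comparisons. Hence 0 may replace the minimum of the
  cycle or the least letter at which a word is cut.\<close>

lemma even_dasc_cong:
  assumes "\<forall>y\<in>set w. a < y \<and> b < y" "\<forall>y\<in>set w. a' < y \<and> b' < y"
  shows "even_dasc a w b = even_dasc a' w b'"
proof -
  have "even_dasc a w b = even_dasc a w b'"
    using assms by (intro even_dasc_right_cong) auto
  also have "\<dots> = even_dasc a' w b'"
    using assms by (cases w) auto
  finally show ?thesis .
qed

text \<open>The boundary 0 stands for the minimum of the cycle on both sides; this is faithful for
  words of positive letters.\<close>

definition hop :: "nat list \<Rightarrow> nat list" where
  "hop w = fold linear_shift (even_dasc 0 w 0) w"

lemma hop_Nil [simp]: "hop [] = []"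
  by (simp add: hop_def)

lemma set_hop [simp]: "set (hop w) = set w"
  by (simp add: hop_def fold_linear_shift_set set_even_dasc)

lemma hop_eq_Nil_iff [simp]: "hop w = [] \<longleftrightarrow> w = []"
  by (metis set_hop set_empty)

lemma distinct_hop: "distinct w \<Longrightarrow> distinct (hop w)"
  by (simp add: hop_def fold_linear_shift_distinct set_even_dasc)

text \<open>The least letter \<open>k\<close> is a double ascent exactly if \<open>u\<close> is
  empty and \<open>v\<close> is not: otherwise its left neighbour is larger or its right neighbour
  is 0. For \<open>u = []\<close> and \<open>v = []\<close> the two branches agree.\<close>

lemma hop_split:
  assumes dist: "distinct (u @ k # v)" and less: "\<forall>y\<in>set u \<union> set v. k < y" and pos: "0 < k"
  shows "hop (u @ k # v) = (if u = [] \<and> even k then hop v @ [k] else hop u @ k # hop v)"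
proof -
  have dv: "even_dasc k v 0 = even_dasc 0 v 0"
    using less by (intro even_dasc_cong) auto
  have du: "even_dasc 0 u k = even_dasc 0 u 0"
    using less by (intro even_dasc_cong) auto
  let ?K = "if u = [] \<and> even k \<and> v \<noteq> [] then [k] else []"
  have K: "even_dasc (last (0 # u)) (k # v) 0 = ?K @ even_dasc 0 v 0"
  proof (cases "u = []")
    case True
    then show ?thesis using pos less dv by (cases v) auto
  next
    case False
    then have "k < last u" using less by auto
    then show ?thesis using False dv by (auto simp: hd_append)
  qed
  have E: "even_dasc 0 (u @ k # v) 0 = even_dasc 0 u 0 @ ?K @ even_dasc 0 v 0"
    using du K even_dasc_append by simp
  have "fold linear_shift (even_dasc 0 u 0) (u @ k # v) = hop u @ k # v"
    unfolding hop_def using less set_even_dasc[of 0 u 0]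
    by (intro fold_linear_shift_append_left) auto
  \<comment> \<open>The letters are shifted in the order of writing: those of \<open>u\<close>, then
    possibly \<open>k\<close>, then those of \<open>v\<close>.\<close>
  then have 1: "hop (u @ k # v) = fold linear_shift (even_dasc 0 v 0)
      (fold linear_shift ?K (hop u @ k # v))"
    by (simp add: hop_def E)
  show ?thesis
  proof (cases "u = [] \<and> even k \<and> v \<noteq> []")
    case True
    have "takeWhile (\<lambda>y. k < y) v = v" "dropWhile (\<lambda>y. k < y) v = []"
      using less by simp_all
    then have "linear_shift k ([] @ k # v) = v @ k # []"
      by (subst linear_shift_eq) simp_all
    then have "hop (u @ k # v) = fold linear_shift (even_dasc 0 v 0) (v @ k # [])"
      using 1 True by simp
    \<comment> \<open>Having passed all of \<open>v\<close>, the letter \<open>k\<close> is now the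
      wall on its right.\<close>
    also have "\<dots> = hop v @ k # []"
      unfolding hop_def using less set_even_dasc[of 0 v 0]
      by (intro fold_linear_shift_append_left) auto
    finally show ?thesis using True by simp
  next
    case False
    then have "hop (u @ k # v) = fold linear_shift (even_dasc 0 v 0) ((hop u @ [k]) @ v)"
      using 1 by auto
    also have "\<dots> = (hop u @ [k]) @ hop v"
      unfolding hop_def[of v] using dist set_even_dasc[of 0 v 0]
      by (intro fold_linear_shift_append_right) auto
    finally show ?thesis using False by auto
  qed
qed

text \<open>
  In both definitions the last letter is followed, in its cycle, by a smaller letter; the relation
  on consecutive letters makes it even.
\<close>

definition hat_word :: "nat list \<Rightarrow> bool" where
  "hat_word w \<longleftrightarrow> successively (\<lambda>a b. b < a \<longrightarrow> even a \<and> odd b) w \<and> (w \<noteq> [] \<longrightarrow> even (last w))"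

definition dumont_word :: "nat list \<Rightarrow> bool" where
  "dumont_word w \<longleftrightarrow> successively (\<lambda>a b. (odd a \<longrightarrow> a < b) \<and> (even a \<longrightarrow> b < a)) w
     \<and> (w \<noteq> [] \<longrightarrow> even (last w))"

lemma hat_word_Nil [simp]: "hat_word []"
  by (simp add: hat_word_def)

lemma dumont_word_Nil [simp]: "dumont_word []"
  by (simp add: dumont_word_def)

text \<open>If \<open>u\<close> is nonempty, the descent from \<open>last u\<close> to
  \<open>k\<close> forces \<open>last u\<close> even and \<open>k\<close> odd, so an even
  \<open>k\<close> must stand first. An odd \<open>k\<close> cannot be last, whence
  \<open>v \<noteq> []\<close>.\<close>

lemma hat_word_split:
  assumes "\<forall>y\<in>set u \<union> set v. k < y"
  shows "hat_word (u @ k # v) \<longleftrightarrow>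
    (if even k then u = [] \<and> hat_word v else hat_word u \<and> hat_word v \<and> v \<noteq> [])"
proof -
  have "u \<noteq> [] \<Longrightarrow> k < last u" "v \<noteq> [] \<Longrightarrow> k < hd v" using assms by auto
  then show ?thesis by (auto simp: hat_word_def successively_append_iff successively_Cons)
qed

text \<open>An even \<open>k\<close> would need a smaller successor, so it stands last; an odd
  \<open>k\<close> cannot stand last. The descent from \<open>last u\<close> to \<open>k\<close>
  makes \<open>last u\<close> even.\<close>

lemma dumont_word_split:
  assumes "\<forall>y\<in>set u \<union> set v. k < y"
  shows "dumont_word (u @ k # v) \<longleftrightarrow>
    (if even k then v = [] \<and> dumont_word u else dumont_word u \<and> dumont_word v \<and> v \<noteq> [])"
proof -
  have "u \<noteq> [] \<Longrightarrow> k < last u" "v \<noteq> [] \<Longrightarrow> k < hd v" using assms by auto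
  then show ?thesis by (auto simp: dumont_word_def successively_append_iff successively_Cons)
qed

text \<open>The two splitting criteria correspond under \<open>hop\<close>: an even \<open>k\<close>
  moves from the front to the end, an odd \<open>k\<close> stays between the two parts.\<close>

lemma dumont_word_hop:
  "distinct w \<Longrightarrow> 0 \<notin> set w \<Longrightarrow> hat_word w \<Longrightarrow> dumont_word (hop w)"
proof (induction w rule: min_split_induct)
  case (split u k v)
  have less: "\<forall>y\<in>set u \<union> set v. k < y" by (fact split.hyps)
  show ?case
  proof (cases "even k")
    case True
    then have "u = []" "hat_word v"
      using split.prems(2) hat_word_split[OF less] by auto
    then have "dumont_word (hop v)" using split by simp
    then have "dumont_word (hop v @ k # [])"
      using True less dumont_word_split[of "hop v" "[]" k] by simp
    then show ?thesis
      using True \<open>u = []\<close> split.prems(1) hop_split[OF split.hyps(1) less] by simp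
  next
    case False
    then have "hat_word u" "hat_word v" "v \<noteq> []"
      using split.prems(2) hat_word_split[OF less] by auto
    then show ?thesis
      using False split dumont_word_split[of "hop u" "hop v" k] by (simp add: hop_split)
  qed
qed simp

text \<open>Equal images have the same letters, hence the same least letter \<open>k\<close>, and
  its parity decides which form both words have. The images of the two parts can then be read
  off.\<close>

lemma hop_inj:
  "distinct w \<Longrightarrow> 0 \<notin> set w \<Longrightarrow> hat_word w \<Longrightarrow> distinct w' \<Longrightarrow> hat_word w' \<Longrightarrow>
     hop w = hop w' \<Longrightarrow> w = w'"
proof (induction w arbitrary: w' rule: min_split_induct)
  case Nil
  then have "hop w' = []" by simp
  then show ?case by simp
next
  case (split u k v)
  have less: "\<forall>y\<in>set u \<union> set v. k < y" by (fact split.hyps)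
  have sets: "set w' = set (u @ k # v)"
    using split.prems(5) by (metis set_hop)
  then have "k \<in> set w'" by simp
  then obtain u' v' where w': "w' = u' @ k # v'"
    by (meson split_list)
  have d': "distinct (u' @ k # v')" using split.prems(3) w' by simp
  have "set u' \<union> set v' = set w' - {k}" "set u \<union> set v = set (u @ k # v) - {k}"
    using w' d' split.hyps(1) by auto
  then have less': "\<forall>y\<in>set u' \<union> set v'. k < y"
    using less unfolding sets by metis
  have pos: "0 < k" "0 \<notin> set u" "0 \<notin> set v"
    using split.prems(1) by auto
  have dist: "distinct u'" "distinct v'" using d' by auto
  have hat: "hat_word (u @ k # v)" "hat_word (u' @ k # v')"
    using split.prems(2,4) w' by auto
  have eq: "hop (u @ k # v) = hop (u' @ k # v')" using split.prems(5) w' by simp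
  show ?case
  proof (cases "even k")
    case True
    then have h: "u = []" "hat_word v" "u' = []" "hat_word v'"
      using hat hat_word_split[OF less] hat_word_split[OF less'] by auto
    have "hop v @ [k] = hop v' @ [k]"
      using eq True h(1,3) hop_split[OF split.hyps(1) less pos(1)] hop_split[OF d' less' pos(1)]
      by simp
    then have "hop v = hop v'" by simp
    then have "v = v'" using split.IH(2) pos(3) h dist(2) by blast
    then show ?thesis using h(1,3) w' by simp
  next
    case False
    then have h: "hat_word u" "hat_word v" "hat_word u'" "hat_word v'"
      using hat hat_word_split[OF less] hat_word_split[OF less'] by auto
    have "hop u @ k # hop v = hop u' @ k # hop v'"
      using eq False hop_split[OF split.hyps(1) less pos(1)] hop_split[OF d' less' pos(1)]
      by simp
    \<comment> \<open>A single occurrence of \<open>k\<close> on each side makes the decomposition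
      around it unique.\<close>
    moreover have "k \<notin> set (hop u)" "k \<notin> set (hop u')" "k \<notin> set (hop v)" "k \<notin> set (hop v')"
      using split.hyps(1) d' by auto
    ultimately have "hop u = hop u'" "hop v = hop v'"
      by (simp_all add: append_Cons_eq_iff)
    then have "u = u'" "v = v'" using split.IH pos(2,3) h dist by blast+
    then show ?thesis using w' by simp
  qed
qed

lemma hop_surj:
  "distinct w \<Longrightarrow> 0 \<notin> set w \<Longrightarrow> dumont_word w \<Longrightarrow>
     \<exists>w'. distinct w' \<and> set w' = set w \<and> hat_word w' \<and> hop w' = w"
proof (induction w rule: min_split_induct)
  case Nil
  then show ?case by simp
next
  case (split u k v)
  have less: "\<forall>y\<in>set u \<union> set v. k < y" by (fact split.hyps)
  have pos: "0 < k" "0 \<notin> set u" "0 \<notin> set v"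
    using split.prems(1) by auto
  show ?case
  proof (cases "even k")
    case True
    then have "v = []" "dumont_word u"
      using split.prems(2) dumont_word_split[OF less] by auto
    then obtain u' where u': "distinct u'" "set u' = set u" "hat_word u'" "hop u' = u"
      using split.IH(1) pos by auto
    \<comment> \<open>The preimage of \<open>u @ [k]\<close> moves \<open>k\<close> back to the
      front; it is written with an empty left part to fit the splitting lemmas.\<close>
    have l: "\<forall>y\<in>set [] \<union> set u'. k < y" using less u' by auto
    have "distinct ([] @ k # u')" using split.hyps(1) u' by auto
    moreover have "hat_word ([] @ k # u')" using hat_word_split[OF l] True u' by simp
    moreover have "hop ([] @ k # u') = u @ [k]"
      using hop_split[OF \<open>distinct ([] @ k # u')\<close> l pos(1)] True u' by simp
    ultimately show ?thesis using u' \<open>v = []\<close> by (intro exI[of _ "[] @ k # u'"]) auto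
  next
    case False
    then have "dumont_word u" "dumont_word v" "v \<noteq> []"
      using split.prems(2) dumont_word_split[OF less] by auto
    then obtain u' where u': "distinct u'" "set u' = set u" "hat_word u'" "hop u' = u"
      using split.IH(1) pos by auto
    obtain v' where v': "distinct v'" "set v' = set v" "hat_word v'" "hop v' = v"
      using split.IH(2) pos \<open>dumont_word v\<close> by auto
    have l: "\<forall>y\<in>set u' \<union> set v'. k < y" using less u' v' by auto
    have "distinct (u' @ k # v')" using split.hyps(1) u' v' by auto
    moreover have "hat_word (u' @ k # v')"
      using hat_word_split[OF l] False u' v' \<open>v \<noteq> []\<close> by auto
    moreover have "hop (u' @ k # v') = u @ k # v"
      using hop_split[OF \<open>distinct (u' @ k # v')\<close> l pos(1)] False u' v' by simp
    ultimately show ?thesis using u' v' by (intro exI[of _ "u' @ k # v'"]) auto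
  qed
qed

section \<open>Shifting inside a cycle\<close>

text \<open>This is the bridge to the indexed form of \<open>even_cdasc\<close>:
  \<open>(a # w) ! i\<close> and \<open>(w @ [b]) ! Suc i\<close> are the left and right neighbours
  of \<open>w ! i\<close>.\<close>

lemma even_dasc_conv_nth:
  "even_dasc a w b = map ((!) w) (filter (\<lambda>i. even (w ! i) \<and> (a # w) ! i < w ! i
     \<and> w ! i < (w @ [b]) ! Suc i) [0..<length w])"
proof (induction w arbitrary: a)
  case (Cons y ys)
  have "[0..<length (y # ys)] = 0 # map Suc [0..<length ys]"
    by (simp add: upt_conv_Cons map_Suc_upt del: upt_Suc)
  then show ?case
    unfolding even_dasc.simps Cons.IH by (simp add: filter_map o_def hd_conv_nth del: upt_Suc)
qed simp

text \<open>The minimum \<open>m\<close> is never a double ascent, and it is the cyclic neighbour of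
  both ends of \<open>w\<close>, hence the boundary letter on both sides.\<close>

lemma even_cdasc_Cons:
  assumes "\<forall>y\<in>set w. m < y"
  shows "even_cdasc (m # w) = even_dasc m w m"
proof -
  let ?c = "m # w" and ?k = "Suc (length w)"
  \<comment> \<open>\<open>P\<close> is the test at a position of the cycle, \<open>Q\<close> the
    test at a position of \<open>w\<close>; position \<open>i\<close> of \<open>w\<close> is
    position \<open>Suc i\<close> of the cycle.\<close>
  define P where "P i \<longleftrightarrow> even (?c ! i) \<and>
    ?c ! ((i + ?k - 1) mod ?k) < ?c ! i \<and> ?c ! i < ?c ! ((i + 1) mod ?k)" for i
  define Q where "Q i \<longleftrightarrow> even (w ! i) \<and> ?c ! i < w ! i \<and> w ! i < (w @ [m]) ! Suc i" for i
  have upt: "[0..<?k] = 0 # map Suc [0..<length w]"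
    by (simp add: upt_conv_Cons map_Suc_upt del: upt_Suc)
  \<comment> \<open>Whatever letter precedes \<open>m\<close> cyclically, possibly \<open>m\<close>
    itself, it lies in the cycle and so is at least \<open>m\<close>.\<close>
  have "?c ! j \<in> set ?c" if "j < ?k" for j
    using that by (intro nth_mem) simp
  then have "?c ! ((0 + ?k - 1) mod ?k) \<in> set ?c"
    by simp
  then have "m \<le> ?c ! ((0 + ?k - 1) mod ?k)"
    using assms by (metis less_imp_le order_refl set_ConsD)
  then have "\<not> P 0" unfolding P_def by (metis nth_Cons_0 not_less)
  moreover have "P (Suc i) \<longleftrightarrow> Q i" if "i < length w" for i
  proof -
    have "Suc i + ?k - 1 = i + ?k" by simp
    then have "(Suc i + ?k - 1) mod ?k = i" using that by (metis mod_add_self2 mod_less less_SucI)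
    \<comment> \<open>At the last position of \<open>w\<close> the index wraps around to 0, where
      \<open>m\<close> stands.\<close>
    moreover have "?c ! ((Suc i + 1) mod ?k) = (w @ [m]) ! Suc i"
    proof (cases "Suc i = length w")
      case True
      then show ?thesis by simp
    next
      case False
      then have "Suc i < length w" using that by simp
      then show ?thesis by (simp add: nth_append)
    qed
    ultimately show ?thesis unfolding P_def Q_def by (metis nth_Cons_Suc)
  qed
  moreover from this have "filter (\<lambda>i. P (Suc i)) [0..<length w] = filter Q [0..<length w]"
    by (intro filter_cong) auto
  ultimately have "map ((!) ?c) (filter P [0..<?k]) = map ((!) w) (filter Q [0..<length w])"
    unfolding upt by (simp add: filter_map o_def)
  then show ?thesis
    unfolding even_cdasc_def even_dasc_conv_nth Let_def P_def Q_def by (simp only: length_Cons)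
qed

text \<open>With distinct entries, rewriting a cycle from \<open>x\<close> does not depend on where
  the list was cut open.\<close>

lemma rotate_to_rotate:
  assumes "distinct c" "x \<in> set c"
  shows "rotate_to x (rotate n c) = rotate_to x c"
proof -
  have rot1: "rotate_to x (rotate1 c) = rotate_to x c" if "distinct c" "x \<in> set c" for c
  proof (cases c)
    case (Cons y ys)
    show ?thesis
    proof (cases "y = x")
      case True
      then have "takeWhile (\<lambda>y. y \<noteq> x) ys = ys" "dropWhile (\<lambda>y. y \<noteq> x) ys = []"
        using that Cons by (auto simp: takeWhile_eq_all_conv)
      then show ?thesis using True Cons that
        by (auto simp: rotate_to_def dropWhile_append takeWhile_append)
    next
      case False
      then show ?thesis using Cons that
        by (auto simp: rotate_to_def dropWhile_append takeWhile_append)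
    qed
  qed (use that in simp)
  show ?thesis using assms by (induction n) (simp_all add: rot1)
qed

text \<open>Written from \<open>x\<close>, the cycle reads \<open>x # v @ m # u\<close>, and
  \<open>m < x\<close> stops \<open>x\<close> inside \<open>v\<close>. Rotating
  \<open>m # linear_shift x w\<close> by the length of \<open>m # u\<close> gives the same
  list.\<close>

lemma shift_right_rotate:
  assumes dist: "distinct (m # w)" and x: "x \<in> set w" and "m < x"
  shows "\<exists>n'. shift_right x (rotate n (m # w)) = rotate n' (m # linear_shift x w)"
proof -
  obtain u v where w: "w = u @ x # v" "x \<notin> set u" using x by (meson split_list_first)
  have "\<forall>y\<in>set u. y \<noteq> x" using w by blast
  then have tw: "takeWhile (\<lambda>y. y \<noteq> x) w = u" "dropWhile (\<lambda>y. y \<noteq> x) w = x # v"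
    unfolding w(1) by simp_all
  have "rotate_to x (rotate n (m # w)) = rotate_to x (m # w)"
    using dist x by (intro rotate_to_rotate) auto
  also have "\<dots> = x # v @ m # u"
    using tw \<open>m < x\<close> by (simp add: rotate_to_def)
  finally have "shift_right x (rotate n (m # w))
      = takeWhile (\<lambda>y. x < y) (v @ m # u) @ x # dropWhile (\<lambda>y. x < y) (v @ m # u)"
    by (simp add: shift_right_def Let_def)
  moreover have "takeWhile (\<lambda>y. x < y) (v @ m # u) = takeWhile (\<lambda>y. x < y) v"
    "dropWhile (\<lambda>y. x < y) (v @ m # u) = dropWhile (\<lambda>y. x < y) v @ m # u"
    using \<open>m < x\<close> by (induction v) auto
  ultimately have "shift_right x (rotate n (m # w))
      = (takeWhile (\<lambda>y. x < y) v @ x # dropWhile (\<lambda>y. x < y) v) @ (m # u)"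
    by simp
  also have "\<dots> = rotate (length (m # u)) (m # linear_shift x w)"
    using rotate_append[of "m # u"] w by (simp add: linear_shift_eq)
  finally show ?thesis by blast
qed

text \<open>Every shift may leave the cycle cut open elsewhere, so the induction allows an arbitrary
  initial rotation.\<close>

lemma fold_shift_right_rotate:
  "distinct (m # w) \<Longrightarrow> \<forall>y\<in>set w. m < y \<Longrightarrow> set es \<subseteq> set w \<Longrightarrow>
     \<exists>n'. fold shift_right es (rotate n (m # w)) = rotate n' (m # fold linear_shift es w)"
proof (induction es arbitrary: n w)
  case (Cons x es)
  obtain n' where n': "shift_right x (rotate n (m # w)) = rotate n' (m # linear_shift x w)"
    using shift_right_rotate[of m w x n] Cons.prems by auto
  have "distinct (m # linear_shift x w)" "\<forall>y\<in>set (linear_shift x w). m < y"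
    "set es \<subseteq> set (linear_shift x w)"
    using Cons.prems by (auto simp: set_linear_shift distinct_linear_shift)
  from Cons.IH[OF this, of n'] show ?case using n' by simp
qed auto

text \<open>Nothing is shifted past the minimum \<open>m\<close>, so the cyclic shifts act on the word \<open>w\<close> alone.\<close>

lemma cycle_of_list_shift_cycle:
  assumes "distinct (m # w)" "\<forall>y\<in>set w. m < y"
  shows "cycle_of_list (shift_cycle (m # w)) = cycle_of_list (m # hop w)"
proof -
  \<comment> \<open>The letters of \<open>w\<close> exceed \<open>m\<close> and are therefore
    positive, so the boundary \<open>m\<close> may be replaced by 0.\<close>
  have "even_cdasc (m # w) = even_dasc 0 w 0"
    using assms(2) even_dasc_cong[of w m m 0 0] by (fastforce simp: even_cdasc_Cons)
  then obtain n where "shift_cycle (m # w) = rotate n (m # hop w)"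
    using fold_shift_right_rotate[OF assms set_even_dasc[of 0 w 0], of 0]
    by (auto simp: shift_cycle_def hop_def)
  moreover have "distinct (m # hop w)"
    using assms(1) by (simp add: distinct_hop)
  ultimately show ?thesis
    using cycle_of_list_rotate_independent by metis
qed

section \<open>Canonical cycle notation\<close>

text \<open>The same lists are read in two ways: as words on \<open>A\<close> cut at their
  left-to-right minima, and as canonical cycle notations of permutations of \<open>A\<close>, with
  fixed points as singletons.\<close>

definition canonical_cycles :: "nat set \<Rightarrow> nat list list set" where
  "canonical_cycles A = {cs. (\<forall>c\<in>set cs. c \<noteq> [] \<and> (\<forall>y\<in>set (tl c). hd c < y)) \<and>
     sorted_wrt (\<lambda>c d. hd d < hd c) cs \<and> distinct (concat cs) \<and> set (concat cs) = A}"

lemma canonical_cyclesD: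
  assumes "cs \<in> canonical_cycles A"
  shows "\<And>c. c \<in> set cs \<Longrightarrow> c \<noteq> []"
    and "\<And>c y. c \<in> set cs \<Longrightarrow> y \<in> set (tl c) \<Longrightarrow> hd c < y"
    and "sorted_wrt (\<lambda>c d. hd d < hd c) cs" and "distinct (concat cs)" and "set (concat cs) = A"
    and "\<And>c. c \<in> set cs \<Longrightarrow> distinct c"
  using assms by (auto simp: canonical_cycles_def distinct_concat_iff)

lemma canonical_cycles_hd_le:
  assumes "cs \<in> canonical_cycles A" "c \<in> set cs" "y \<in> set c"
  shows "hd c \<le> y"
  using canonical_cyclesD(1,2)[OF assms(1,2)] assms(3) by (cases c) (auto intro: less_imp_le)

text \<open>The least letter \<open>k\<close> opens the last block, which is \<open>k # v\<close>;
  the earlier blocks are those of \<open>u\<close>, and their heads are larger.\<close>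

lemma ex_canonical_cycles:
  "distinct w \<Longrightarrow> \<exists>cs\<in>canonical_cycles (set w). concat cs = w"
proof (induction w rule: min_split_induct)
  case Nil
  then show ?case by (intro bexI[of _ "[]"]) (auto simp: canonical_cycles_def)
next
  case (split u k v)
  then obtain cs where cs: "cs \<in> canonical_cycles (set u)" "concat cs = u" by blast
  have "hd c \<in> set u" if "c \<in> set cs" for c
    using that cs(2) hd_in_set[OF canonical_cyclesD(1)[OF cs(1) that]] by auto
  then have "cs @ [k # v] \<in> canonical_cycles (set (u @ k # v))"
    using cs split.hyps by (auto simp: canonical_cycles_def sorted_wrt_append)
  moreover have "concat (cs @ [k # v]) = u @ k # v" using cs(2) by simp
  ultimately show ?case by blast
qed

section \<open>Left-to-right minima and recovery of the blocks\<close>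

definition lr_minima :: "nat list \<Rightarrow> nat set" where
  "lr_minima w = {x. \<exists>u v. w = u @ x # v \<and> (\<forall>y\<in>set u. x < y)}"

text \<open>A head is below all earlier blocks because heads decrease and each is the minimum of its
  block. Any other entry comes after the smaller head of its own block.\<close>

lemma lr_minima_concat:
  assumes cs: "cs \<in> canonical_cycles A"
  shows "lr_minima (concat cs) = hd ` set cs"
proof (intro set_eqI iffI)
  fix x assume "x \<in> hd ` set cs"
  then obtain c where c: "c \<in> set cs" "x = hd c" by blast
  then obtain cs1 cs2 where split: "cs = cs1 @ c # cs2" by (meson split_list)
  have "x < y" if "y \<in> set (concat cs1)" for y
  proof -
    obtain d where d: "d \<in> set cs1" "y \<in> set d" using \<open>y \<in> set (concat cs1)\<close> by auto
    then have "x < hd d"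
      using canonical_cyclesD(3)[OF cs] split c by (auto simp: sorted_wrt_append)
    also have "\<dots> \<le> y" using canonical_cycles_hd_le[OF cs] d split by auto
    finally show ?thesis .
  qed
  moreover have "concat cs = concat cs1 @ x # (tl c @ concat cs2)"
    using split c canonical_cyclesD(1)[OF cs c(1)] by (cases c) auto
  ultimately show "x \<in> lr_minima (concat cs)"
    unfolding lr_minima_def by blast
next
  fix x assume "x \<in> lr_minima (concat cs)"
  then obtain u v where uv: "concat cs = u @ x # v" "\<forall>y\<in>set u. x < y"
    unfolding lr_minima_def by blast
  then have "x \<in> set (concat cs)" by simp
  then obtain c where c: "c \<in> set cs" "x \<in> set c" by auto
  then obtain cs1 cs2 where split: "cs = cs1 @ c # cs2" by (meson split_list)
  have "x = hd c"
  proof (rule ccontr)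
    assume "x \<noteq> hd c"
    then have "x \<in> set (tl c)" using c by (cases c) auto
    then obtain t1 t2 where "tl c = t1 @ x # t2" by (meson split_list)
    then have eq: "concat cs = (concat cs1 @ hd c # t1) @ x # (t2 @ concat cs2)"
      using split c canonical_cyclesD(1)[OF cs c(1)] by (cases c) auto
    \<comment> \<open>As \<open>x\<close> occurs only once, \<open>u\<close> is the prefix found
      from the blocks, and this prefix contains \<open>hd c\<close>.\<close>
    have "distinct (u @ x # v)"
      using canonical_cyclesD(4)[OF cs] uv by simp
    then have "x \<notin> set u" "x \<notin> set v" by auto
    moreover have "u @ x # v = (concat cs1 @ hd c # t1) @ x # (t2 @ concat cs2)"
      by (rule trans[OF uv(1)[symmetric] eq])
    ultimately have "u = concat cs1 @ hd c # t1 \<and> v = t2 @ concat cs2"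
      by (rule append_Cons_eq_iff[THEN iffD1])
    then have "x < hd c" using uv(2) by auto
    then show False using canonical_cycles_hd_le[OF cs c] by simp
  qed
  then show "x \<in> hd ` set cs" using c by blast
qed

lemma split_at_concat:
  "\<forall>c\<in>set cs. c \<noteq> [] \<and> hd c \<in> M \<and> set (tl c) \<inter> M = {} \<Longrightarrow> split_at M (concat cs) = cs"
proof (induction cs)
  case (Cons c cs)
  then obtain x xs where c: "c = x # xs" by (cases c) auto
  have xs: "\<forall>y\<in>set xs. y \<notin> M" using Cons.prems c by auto
  \<comment> \<open>The remaining word is empty or starts with a letter of \<open>M\<close>, so
    \<open>takeWhile\<close> stops exactly at the end of the first block.\<close>
  have "concat cs = [] \<or> hd (concat cs) \<in> M" using Cons.prems by (cases cs) auto
  then have "takeWhile (\<lambda>y. y \<notin> M) (concat cs) = []"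
    "dropWhile (\<lambda>y. y \<notin> M) (concat cs) = concat cs"
    by (cases "concat cs"; simp del: concat_eq_Nil_conv)+
  then have "takeWhile (\<lambda>y. y \<notin> M) (xs @ concat cs) = xs"
    "dropWhile (\<lambda>y. y \<notin> M) (xs @ concat cs) = concat cs"
    using xs by simp_all
  then show ?case using c Cons by simp
qed simp

text \<open>This inverts the erasing of parentheses; it yields injectivity of \<open>concat\<close>
  and computes the blocks in \<open>hat_cycles\<close>.\<close>

lemma split_at_lr_minima:
  assumes cs: "cs \<in> canonical_cycles A"
  shows "split_at (lr_minima (concat cs)) (concat cs) = cs"
proof (rule split_at_concat, intro ballI conjI)
  fix c assume c: "c \<in> set cs"
  show "c \<noteq> []" using canonical_cyclesD(1)[OF cs c] .
  show "hd c \<in> lr_minima (concat cs)" using lr_minima_concat[OF cs] c by simp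
  have "hd d \<noteq> y" if d: "d \<in> set cs" and y: "y \<in> set (tl c)" for d y
  proof
    assume eq: "hd d = y"
    have "y \<in> set c" using y by (cases c) auto
    moreover have "y \<in> set d" using eq canonical_cyclesD(1)[OF cs d] by auto
    ultimately have "c = d"
      using c d canonical_cyclesD(4)[OF cs] by (auto simp: distinct_concat_iff)
    then show False using canonical_cyclesD(2)[OF cs c y] eq by simp
  qed
  then show "set (tl c) \<inter> lr_minima (concat cs) = {}"
    unfolding lr_minima_concat[OF cs] by auto
qed

lemma concat_inj_on_canonical: "inj_on concat (canonical_cycles A)"
  by (rule inj_on_inverseI[of _ "\<lambda>w. split_at (lr_minima w) w"]) (rule split_at_lr_minima)

text \<open>\<open>concat\<close> is a bijection onto the arrangements of \<open>A\<close>. The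
  count later turns injectivity of \<open>perm_of_cycles\<close> into surjectivity.\<close>

lemma card_canonical_cycles:
  assumes "finite A"
  shows "card (canonical_cycles A) = fact (card A)"
proof -
  have "concat ` canonical_cycles A = permutations_of_set A"
  proof (intro equalityI subsetI)
    fix w assume "w \<in> permutations_of_set A"
    then have "distinct w" "set w = A" by (simp_all add: permutations_of_set_def)
    then show "w \<in> concat ` canonical_cycles A" using ex_canonical_cycles by blast
  qed (auto intro!: permutations_of_setI simp: canonical_cycles_def)
  then show ?thesis
    using card_image[OF concat_inj_on_canonical, of A] assms by simp
qed

section \<open>Permutations given by disjoint cycles\<close>

lemma perm_of_cycles_Cons: "perm_of_cycles (c # cs) = cycle_of_list c \<circ> perm_of_cycles cs"
  by (simp add: perm_of_cycles_def)

lemma perm_of_cycles_outside: "y \<notin> set (concat cs) \<Longrightarrow> perm_of_cycles cs y = y"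
  by (induction cs) (auto simp: perm_of_cycles_def id_outside_supp)

lemma perm_of_cycles_permutes: "perm_of_cycles cs permutes set (concat cs)"
proof (induction cs)
  case (Cons c cs)
  show ?case unfolding perm_of_cycles_Cons
    by (rule permutes_compose)
      (use Cons cycle_permutes in \<open>auto intro: permutes_subset\<close>)
qed (simp add: perm_of_cycles_def id_def permutes_def)

lemma cycle_of_list_in: "y \<in> set c \<Longrightarrow> cycle_of_list c y \<in> set c"
  by (simp add: permutes_in_image[OF cycle_permutes])

text \<open>The supports are disjoint: the factors other than \<open>c\<close> fix both
  \<open>y\<close> and its image, which stays in \<open>c\<close>.\<close>

lemma perm_of_cycles_eq:
  "distinct (concat cs) \<Longrightarrow> c \<in> set cs \<Longrightarrow> y \<in> set c \<Longrightarrow> perm_of_cycles cs y = cycle_of_list c y"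
proof (induction cs)
  case (Cons d cs)
  show ?case
  proof (cases "y \<in> set d")
    case True
    then have "y \<notin> set (concat cs)" "c = d"
      using Cons.prems by auto
    then show ?thesis by (simp add: perm_of_cycles_Cons perm_of_cycles_outside)
  next
    case False
    then have c: "c \<in> set cs" using Cons.prems by auto
    then have "cycle_of_list c y \<notin> set d"
      using Cons.prems cycle_of_list_in[of y c] by auto
    then show ?thesis using Cons c by (simp add: perm_of_cycles_Cons id_outside_supp)
  qed
qed simp

lemma cycle_of_list_nth:
  assumes "distinct c" "i < length c"
  shows "cycle_of_list c (c ! i) = c ! (Suc i mod length c)"
proof -
  have "map (cycle_of_list c) c = rotate1 c"
    using cyclic_rotation[OF assms(1), of 1] by simp
  then show ?thesis
    using assms(2) nth_map[of i c "cycle_of_list c"] by (simp add: nth_rotate1)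
qed

lemma funpow_cycle_of_list:
  assumes "distinct c" "i < length c"
  shows "(cycle_of_list c ^^ i) (hd c) = c ! i"
  using assms(2)
proof (induction i)
  case 0
  then show ?case by (simp add: hd_conv_nth)
next
  case (Suc i)
  then show ?case using cycle_of_list_nth[OF assms(1), of i] by simp
qed

text \<open>Iteration from the head recovers the written cycle, which serves both to compute orbits
  and to prove uniqueness of the notation.\<close>

lemma funpow_perm_of_cycles:
  assumes "distinct (concat cs)" "c \<in> set cs" "i < length c"
  shows "(perm_of_cycles cs ^^ i) (hd c) = c ! i"
proof -
  have dist: "distinct c" using assms(1,2) by (simp add: distinct_concat_iff)
  have "(perm_of_cycles cs ^^ i) (hd c) = (cycle_of_list c ^^ i) (hd c)"
    using assms(3)
  proof (induction i)
    case (Suc i)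
    then have "(cycle_of_list c ^^ i) (hd c) \<in> set c"
      using funpow_cycle_of_list[OF dist, of i] by simp
    then show ?case using Suc perm_of_cycles_eq[OF assms(1,2)] by simp
  qed simp
  then show ?thesis using funpow_cycle_of_list[OF dist assms(3)] by simp
qed

lemma orbit_perm_of_cycles:
  assumes "distinct (concat cs)" "c \<in> set cs" "y \<in> set c"
  shows "orbit (perm_of_cycles cs) y = set c"
proof -
  let ?p = "perm_of_cycles cs"
  have perm: "permutation ?p"
    using perm_of_cycles_permutes by (auto simp: permutation_permutes)
  have "c \<noteq> []" using assms(3) by auto
  have "orbit ?p (hd c) = set c"
  proof (intro equalityI subsetI)
    fix x assume "x \<in> orbit ?p (hd c)"
    then show "x \<in> set c"
      using \<open>c \<noteq> []\<close>
      by induction (simp_all add: perm_of_cycles_eq[OF assms(1,2)] cycle_of_list_in)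
  next
    fix x assume "x \<in> set c"
    then obtain i where "i < length c" "x = c ! i" by (auto simp: in_set_conv_nth)
    then have "x = (?p ^^ i) (hd c)"
      using funpow_perm_of_cycles[OF assms(1,2)] by simp
    \<comment> \<open>\<open>orbit\<close> is generated from the image of its base point; for a
      permutation of finite support the zeroth power belongs to it too.\<close>
    then show "x \<in> orbit ?p (hd c)"
      using orbit_altdef_permutation[OF perm] by blast
  qed
  moreover have "hd c \<in> set c" using \<open>c \<noteq> []\<close> by simp
  ultimately have "cyclic_on ?p (set c)" by (intro cyclic_on_singleI) auto
  then show ?thesis using assms(3) by (rule orbit_cyclic_eq3)
qed

lemma Min_canonical_cycle:
  assumes "cs \<in> canonical_cycles A" "c \<in> set cs"
  shows "Min (set c) = hd c"
  using canonical_cycles_hd_le[OF assms] canonical_cyclesD(1)[OF assms]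
  by (intro Min_eqI) auto

lemma Cmin_perm_of_cycles:
  assumes cs: "cs \<in> canonical_cycles {1..m}"
  shows "Cmin m (perm_of_cycles cs) = hd ` set cs"
proof -
  note dist = canonical_cyclesD(4)[OF cs] and un = canonical_cyclesD(5)[OF cs]
  have "orbit (perm_of_cycles cs) ` {1..m} = set ` set cs"
  proof (intro equalityI subsetI)
    fix C assume "C \<in> orbit (perm_of_cycles cs) ` {1..m}"
    then obtain y where y: "y \<in> set (concat cs)" "C = orbit (perm_of_cycles cs) y"
      unfolding un by (rule imageE)
    then obtain c where "c \<in> set cs" "y \<in> set c" by auto
    then show "C \<in> set ` set cs" using orbit_perm_of_cycles[OF dist] y(2) by simp
  next
    fix C assume "C \<in> set ` set cs"
    then obtain c where c: "c \<in> set cs" "C = set c" by blast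
    then have "hd c \<in> set c" using canonical_cyclesD(1)[OF cs] by simp
    moreover from this have "hd c \<in> {1..m}" using c(1) unfolding un[symmetric] by auto
    ultimately show "C \<in> orbit (perm_of_cycles cs) ` {1..m}"
      using orbit_perm_of_cycles[OF dist c(1)] c(2) by (metis imageI)
  qed
  then have "Cmin m (perm_of_cycles cs) = Min ` set ` set cs"
    by (simp add: Cmin_def Setcompr_eq_image)
  also have "\<dots> = hd ` set cs"
    unfolding image_image using Min_canonical_cycle[OF cs] by (intro image_cong) auto
  finally show ?thesis .
qed

text \<open>If the first entries differed, each would follow the other in one of the lists, against
  asymmetry. This fixes the order of the cycles.\<close>

lemma sorted_wrt_asym_unique:
  assumes "\<And>x y. R x y \<Longrightarrow> \<not> R y x"
  shows "sorted_wrt R xs \<Longrightarrow> sorted_wrt R ys \<Longrightarrow> set xs = set ys \<Longrightarrow> xs = ys"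
proof (induction xs arbitrary: ys)
  case (Cons x xs)
  then obtain y ys' where ys: "ys = y # ys'" by (cases ys) auto
  have "x = y"
  proof (rule ccontr)
    assume "x \<noteq> y"
    then have "x \<in> set ys'" "y \<in> set xs" using Cons.prems(3) ys by auto
    then show False using Cons.prems ys assms by auto
  qed
  moreover have "\<not> R z z" for z using assms by blast
  then have "x \<notin> set xs" "y \<notin> set ys'" using Cons.prems(1,2) ys by auto
  ultimately have "set xs = set ys'" using Cons.prems(3) ys by auto
  then show ?case using Cons.IH[of ys'] Cons.prems ys \<open>x = y\<close> by simp
qed simp

text \<open>The permutation determines each cycle: its entries form an orbit, its head is the
  minimum of that orbit, and the rest are iterates of the head. Decreasing heads fix the
  order.\<close>

lemma perm_of_cycles_inj_on_canonical: "inj_on perm_of_cycles (canonical_cycles A)"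
proof -
  have sub: "set cs \<subseteq> set cs'"
    if cs: "cs \<in> canonical_cycles A" and cs': "cs' \<in> canonical_cycles A"
      and eq: "perm_of_cycles cs = perm_of_cycles cs'" for cs cs'
  proof
    fix c assume c: "c \<in> set cs"
    then have h: "hd c \<in> set c" using canonical_cyclesD(1)[OF cs] by simp
    then have "hd c \<in> set (concat cs')"
      using c canonical_cyclesD(5)[OF cs] canonical_cyclesD(5)[OF cs'] by auto
    then obtain c' where c': "c' \<in> set cs'" "hd c \<in> set c'" by auto
    have sets: "set c = set c'"
      using orbit_perm_of_cycles[OF canonical_cyclesD(4)[OF cs] c h]
        orbit_perm_of_cycles[OF canonical_cyclesD(4)[OF cs'] c'] eq by simp
    then have hds: "hd c = hd c'"
      using Min_canonical_cycle[OF cs c] Min_canonical_cycle[OF cs' c'(1)] by simp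
    have len: "length c = length c'"
      using sets distinct_card[OF canonical_cyclesD(6)[OF cs c]]
        distinct_card[OF canonical_cyclesD(6)[OF cs' c'(1)]] by simp
    have "c ! i = c' ! i" if "i < length c" for i
      using funpow_perm_of_cycles[OF canonical_cyclesD(4)[OF cs] c that]
        funpow_perm_of_cycles[OF canonical_cyclesD(4)[OF cs'] c'(1), of i] that len hds eq by simp
    then have "c = c'" using len by (intro nth_equalityI) auto
    then show "c \<in> set cs'" using c'(1) by simp
  qed
  show ?thesis
  proof (rule inj_onI)
    fix cs cs' assume "cs \<in> canonical_cycles A" "cs' \<in> canonical_cycles A"
      and "perm_of_cycles cs = perm_of_cycles cs'"
    then show "cs = cs'"
      using sub[of cs cs'] sub[of cs' cs]
      by (intro sorted_wrt_asym_unique[of "\<lambda>c d. hd d < hd c"])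
        (auto dest: canonical_cyclesD(3))
  qed
qed

text \<open>An injective map between finite sets with \<open>fact (card A)\<close> elements each is
  onto.\<close>

lemma perm_of_cycles_image_canonical:
  assumes "finite A"
  shows "perm_of_cycles ` canonical_cycles A = {p. p permutes A}"
proof (rule card_subset_eq)
  show "finite {p. p permutes A}" using assms by (rule finite_permutations)
  show "perm_of_cycles ` canonical_cycles A \<subseteq> {p. p permutes A}"
    using perm_of_cycles_permutes by (fastforce dest: canonical_cyclesD(5))
  show "card (perm_of_cycles ` canonical_cycles A) = card {p. p permutes A}"
    using assms by (simp add: card_image[OF perm_of_cycles_inj_on_canonical]
        card_canonical_cycles card_permutations)
qed

section \<open>The map \<open>\<vartheta>\<close> on canonical cycle notations\<close>

lemma length_one_line [simp]: "length (one_line m p) = m"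
  by (simp add: one_line_def)

lemma nth_one_line: "i < m \<Longrightarrow> one_line m p ! i = p (Suc i)"
  by (simp add: one_line_def nth_map del: upt_Suc)

lemma one_line_permutes:
  assumes "p permutes {1..m}"
  shows "distinct (one_line m p)" "set (one_line m p) = {1..m}"
proof -
  have "{1..<m+1} = {1..m}" by auto
  then show "distinct (one_line m p)" "set (one_line m p) = {1..m}"
    using permutes_inj_on[OF assms] permutes_image[OF assms]
    by (simp_all add: one_line_def distinct_map del: upt_Suc)
qed

lemma one_line_inj_on: "inj_on (one_line m) {p. p permutes {1..m}}"
proof (rule inj_onI, rule ext)
  fix p q x assume pq: "p \<in> {p. p permutes {1..m}}" "q \<in> {p. p permutes {1..m}}"
    and eq: "one_line m p = one_line m q"
  show "p x = q x"
  proof (cases "x \<in> {1..m}")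
    case True
    then obtain i where "x = Suc i" "i < m" by (cases x) auto
    then show ?thesis using nth_one_line[of i m p] nth_one_line[of i m q] eq by simp
  next
    case False
    then show ?thesis using pq by (simp add: permutes_not_in)
  qed
qed

lemma one_line_image: "one_line m ` {p. p permutes {1..m}} = permutations_of_set {1..m}"
proof (rule card_subset_eq)
  show "one_line m ` {p. p permutes {1..m}} \<subseteq> permutations_of_set {1..m}"
    using one_line_permutes by (auto intro!: permutations_of_setI)
  show "card (one_line m ` {p. p permutes {1..m}}) = card (permutations_of_set {1..m})"
    using card_image[OF one_line_inj_on, of m] by (simp add: card_permutations)
qed simp

lemma Lrmin_eq_lr_minima: "Lrmin m p = lr_minima (one_line m p)"
proof (intro set_eqI iffI)
  fix x assume "x \<in> Lrmin m p"
  then obtain i where i: "x = p i" "1 \<le> i" "i \<le> m" "\<forall>j\<in>{1..<i}. p i < p j"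
    by (auto simp: Lrmin_def)
  have "[1..<m+1] = [1..<i] @ i # [i+1..<m+1]"
    using i upt_add_eq_append[of 1 i "m + 1 - i"] by (simp add: upt_conv_Cons del: upt_Suc)
  then have "one_line m p = map p [1..<i] @ x # map p [i+1..<m+1]"
    using i(1) by (simp add: one_line_def del: upt_Suc)
  then show "x \<in> lr_minima (one_line m p)"
    using i(1,4) unfolding lr_minima_def by fastforce
next
  fix x assume "x \<in> lr_minima (one_line m p)"
  then obtain u v where uv: "one_line m p = u @ x # v" "\<forall>y\<in>set u. x < y"
    by (auto simp: lr_minima_def)
  \<comment> \<open>List indices start at 0 and positions of the permutation at 1.\<close>
  let ?i = "Suc (length u)"
  have len: "length u < m" using arg_cong[OF uv(1), of length] by simp
  have x: "x = p ?i" using nth_one_line[OF len, of p] uv(1) by simp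
  moreover have "p ?i < p j" if "j \<in> {1..<?i}" for j
  proof -
    obtain k where k: "j = Suc k" "k < length u" using \<open>j \<in> {1..<?i}\<close>
      by (cases j) auto
    then have "p j = u ! k"
      using nth_one_line[of k m p] len uv(1) by (simp add: nth_append)
    moreover have "u ! k \<in> set u" using k by simp
    ultimately show ?thesis using uv(2) x by simp
  qed
  ultimately show "x \<in> Lrmin m p" using len unfolding Lrmin_def by fastforce
qed

lemma GI_iff:
  "p \<in> GI n \<longleftrightarrow> p permutes {1..2*n} \<and>
     successively (\<lambda>a b. a < b \<longrightarrow> odd a \<and> even b) (one_line (2*n) p)"
proof -
  let ?R = "\<lambda>a b :: nat. a < b \<longrightarrow> odd a \<and> even b"
  have "(\<forall>i\<in>{1..<2*n}. ?R (p i) (p (i + 1))) \<longleftrightarrow>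
      (\<forall>i. Suc i < 2*n \<longrightarrow> ?R (p (Suc i)) (p (Suc (Suc i))))" (is "?A \<longleftrightarrow> ?B")
  proof
    assume ?B
    show ?A
    proof
      fix i assume "i \<in> {1..<2*n}"
      then show "?R (p i) (p (i + 1))" using \<open>?B\<close>[rule_format, of "i - 1"] by simp
    qed
  qed auto
  then show ?thesis
    by (auto simp: GI_def successively_conv_nth nth_one_line)
qed

lemma DD_iff:
  "s \<in> DD n \<longleftrightarrow> s permutes {1..2*n} \<and>
     (\<forall>y\<in>{1..2*n}. (odd y \<longrightarrow> y \<le> s y) \<and> (even y \<longrightarrow> s y \<le> y))"
proof -
  have "(\<forall>i\<in>{1..n}. s (2*i) \<le> 2*i \<and> s (2*i - 1) \<ge> 2*i - 1) \<longleftrightarrow>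
      (\<forall>y\<in>{1..2*n}. (odd y \<longrightarrow> y \<le> s y) \<and> (even y \<longrightarrow> s y \<le> y))" (is "?A \<longleftrightarrow> ?B")
  proof
    assume A: ?A
    show ?B
    proof
      fix y assume y: "y \<in> {1..2*n}"
      show "(odd y \<longrightarrow> y \<le> s y) \<and> (even y \<longrightarrow> s y \<le> y)"
      proof (cases "even y")
        case True
        then obtain i where "y = 2 * i" by blast
        then show ?thesis using A y by auto
      next
        case False
        then obtain i where "y = 2 * i + 1" by (elim oddE)
        \<comment> \<open>Here \<open>2 * i + 1 = 2 * Suc i - 1\<close>, so the index to use is
          \<open>Suc i\<close>.\<close>
        then show ?thesis using A[rule_format, of "Suc i"] y by auto
      qed
    qed
  next
    assume B: ?B
    show ?A
    proof
      fix i assume i: "i \<in> {1..n}"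
      then have "odd (2*i - 1)" "2*i \<in> {1..2*n}" "2*i - 1 \<in> {1..2*n}" by auto
      then show "s (2*i) \<le> 2*i \<and> s (2*i - 1) \<ge> 2*i - 1"
        using B by (metis dvd_triv_left)
    qed
  qed
  then show ?thesis by (simp add: DD_def)
qed

section \<open>The two conditions, block by block\<close>

definition hat_block :: "nat list \<Rightarrow> bool" where
  "hat_block c \<longleftrightarrow> tl c = [] \<or> odd (hd c) \<and> hat_word (rev (tl c))"

definition dumont_block :: "nat list \<Rightarrow> bool" where
  "dumont_block c \<longleftrightarrow> tl c = [] \<or> odd (hd c) \<and> dumont_word (tl c)"

text \<open>The head is the minimum, so a longer block begins with an ascent: its head is odd and
  its second letter even. Reversing the tail turns ascents into descents and makes the second letter
  the last one.\<close>

lemma successively_hat_block: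
  assumes "c \<noteq> []" "\<forall>y\<in>set (tl c). hd c < y"
  shows "successively (\<lambda>a b. a < b \<longrightarrow> odd a \<and> even b) c \<longleftrightarrow> hat_block c"
proof -
  obtain m v where c: "c = m # v" using assms(1) by (cases c) auto
  have "v \<noteq> [] \<Longrightarrow> m < hd v" using assms(2) c by simp
  moreover have "successively (\<lambda>x y. x < y \<longrightarrow> even y \<and> odd x) v \<longleftrightarrow>
      successively (\<lambda>x y. x < y \<longrightarrow> odd x \<and> even y) v"
    by (intro successively_cong) auto
  ultimately show ?thesis
    unfolding c hat_block_def hat_word_def successively_rev
    by (auto simp: successively_Cons last_rev)
qed

text \<open>Passing to the next block is a descent, since \<open>last c\<close> is at least
  \<open>hd c\<close> and the next head is smaller; descents carry no condition.\<close>

lemma successively_concat_canonical: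
  assumes "\<forall>c\<in>set cs. c \<noteq> [] \<and> (\<forall>y\<in>set (tl c). hd c < y)"
    "sorted_wrt (\<lambda>c d. hd d < hd c) cs"
  shows "successively (\<lambda>a b. a < b \<longrightarrow> odd a \<and> even b) (concat cs) \<longleftrightarrow>
    (\<forall>c\<in>set cs. successively (\<lambda>a b :: nat. a < b \<longrightarrow> odd a \<and> even b) c)"
  using assms
proof (induction cs)
  case (Cons c cs)
  have "hd (concat cs) < last c" if ne: "concat cs \<noteq> []"
  proof -
    obtain d ds where cs: "cs = d # ds" using ne by (cases cs) auto
    then have "hd (concat cs) = hd d" using Cons.prems(1) by simp
    also have "\<dots> < hd c" using Cons.prems(2) cs by simp
    also have "hd c \<le> last c" using Cons.prems(1) by (cases c) (auto simp: less_imp_le)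
    finally show ?thesis .
  qed
  moreover have "successively (\<lambda>a b. a < b \<longrightarrow> odd a \<and> even b) (concat cs) \<longleftrightarrow>
    (\<forall>c\<in>set cs. successively (\<lambda>a b :: nat. a < b \<longrightarrow> odd a \<and> even b) c)"
    using Cons by simp
  ultimately show ?case
    unfolding concat.simps successively_append_iff by (auto dest: less_asym)
qed simp

text \<open>Appending the head turns the closing step of the cycle into a pair of neighbouring
  letters.\<close>

lemma cycle_of_list_all_iff:
  assumes "distinct c" "c \<noteq> []"
  shows "(\<forall>y\<in>set c. R y (cycle_of_list c y)) \<longleftrightarrow> successively R (c @ [hd c])"
proof -
  have "(c @ [hd c]) ! Suc i = c ! (Suc i mod length c)" if "i < length c" for i
  proof (cases "Suc i = length c")
    case True
    then show ?thesis using assms(2) by (simp add: nth_append hd_conv_nth)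
  next
    case False
    then show ?thesis using that by (simp add: nth_append)
  qed
  then have "successively R (c @ [hd c]) \<longleftrightarrow>
      (\<forall>i<length c. R (c ! i) (cycle_of_list c (c ! i)))"
    unfolding successively_conv_nth
    by (auto simp: cycle_of_list_nth[OF assms(1)] nth_append)
  then show ?thesis by (simp add: all_set_conv_all_nth)
qed

text \<open>In a longer cycle the minimum goes up, hence is odd, and the last entry goes down to it,
  hence is even. A fixed point satisfies both weak inequalities; inside the tail, distinctness makes
  them strict.\<close>

lemma dumont_block_iff:
  assumes "distinct c" "c \<noteq> []" "\<forall>y\<in>set (tl c). hd c < y"
  shows "(\<forall>y\<in>set c. (odd y \<longrightarrow> y \<le> cycle_of_list c y) \<and> (even y \<longrightarrow> cycle_of_list c y \<le> y))
    \<longleftrightarrow> dumont_block c"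
proof -
  let ?R = "\<lambda>a b :: nat. (odd a \<longrightarrow> a \<le> b) \<and> (even a \<longrightarrow> b \<le> a)"
  let ?S = "\<lambda>a b :: nat. (odd a \<longrightarrow> a < b) \<and> (even a \<longrightarrow> b < a)"
  obtain m w where c: "c = m # w" using assms(2) by (cases c) auto
  have strict: "successively ?R w \<longleftrightarrow> successively ?S w"
    using assms(1) unfolding c
    by (induction w) (auto simp: successively_Cons order_le_less)
  have "w \<noteq> [] \<Longrightarrow> m < hd w" "w \<noteq> [] \<Longrightarrow> m < last w" using assms(3) c by auto
  then have "successively ?R (c @ [hd c]) \<longleftrightarrow> w = [] \<or> odd m \<and> successively ?R w \<and> even (last w)"
    unfolding c by (cases "w = []") (auto simp: successively_Cons successively_append_iff)
  also have "\<dots> \<longleftrightarrow> dumont_block c"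
    unfolding strict dumont_block_def dumont_word_def c by auto
  finally show ?thesis using cycle_of_list_all_iff[OF assms(1,2), of ?R] by simp
qed

text \<open>Both steps of \<theta> on one block: \<open>rev\<close> is the effect of
  \<open>flip_block\<close> on the tail, \<open>hop\<close> that of the shifts, up to rotation of
  the cycle.\<close>

definition hop_block :: "nat list \<Rightarrow> nat list" where
  "hop_block c = hd c # hop (rev (tl c))"

text \<open>Rearranging each block behind its fixed head changes neither the multiset of letters nor
  the heads.\<close>

lemma canonical_cycles_map:
  assumes cs: "cs \<in> canonical_cycles A"
    and f: "\<And>c. c \<in> set cs \<Longrightarrow> f c \<noteq> [] \<and> hd (f c) = hd c \<and> distinct (f c) \<and> set (f c) = set c"
  shows "map f cs \<in> canonical_cycles A"
proof -
  have "mset (f c) = mset c" if "c \<in> set cs" for c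
    using f[OF that] canonical_cyclesD(6)[OF cs that] set_eq_iff_mset_eq_distinct by blast
  then have "map (\<lambda>c. mset (f c)) cs = map mset cs" by simp
  then have ms: "mset (concat (map f cs)) = mset (concat cs)"
    by (simp add: mset_concat o_def del: map_eq_conv)
  have "distinct (concat (map f cs))" "set (concat (map f cs)) = A"
    using mset_eq_imp_distinct_iff[OF ms] mset_eq_setD[OF ms]
      canonical_cyclesD(4,5)[OF cs] by simp_all
  moreover have "hd (f c) < y" if c: "c \<in> set cs" and y: "y \<in> set (tl (f c))" for c y
  proof -
    have "y \<in> set c" using f[OF c] y by (metis list.set_sel(2))
    moreover have "y \<noteq> hd (f c)" using f[OF c] y by (cases "f c") auto
    ultimately show ?thesis
      using canonical_cycles_hd_le[OF cs c] f[OF c] by (metis le_neq_implies_less)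
  qed
  moreover have "sorted_wrt (\<lambda>c d. hd d < hd c) (map f cs)"
    unfolding sorted_wrt_map
    using canonical_cyclesD(3)[OF cs] f by (auto elim!: sorted_wrt_mono_rel[rotated])
  ultimately show ?thesis using f by (auto simp: canonical_cycles_def)
qed

lemma hop_block_props:
  assumes "distinct c" "c \<noteq> []"
  shows "hop_block c \<noteq> []" "hd (hop_block c) = hd c" "distinct (hop_block c)"
    "set (hop_block c) = set c"
  using assms by (cases c; auto simp: hop_block_def distinct_hop)+

lemma dumont_block_hop_block:
  assumes "distinct c" "0 \<notin> set c" "hat_block c"
  shows "dumont_block (hop_block c)"
proof (cases c)
  case (Cons m v)
  then show ?thesis
    using assms dumont_word_hop[of "rev v"]
    by (auto simp: hop_block_def hat_block_def dumont_block_def)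
qed (simp add: dumont_block_def hop_block_def)

lemma hop_block_inj:
  assumes "distinct c" "0 \<notin> set c" "c \<noteq> []" "hat_block c"
    and "distinct d" "d \<noteq> []" "hat_block d" and eq: "hop_block c = hop_block d"
  shows "c = d"
proof -
  obtain m v l w where c: "c = m # v" and d: "d = l # w"
    using assms(3,6) by (cases c; cases d) auto
  have eqs: "m = l" "hop (rev v) = hop (rev w)" using eq c d by (simp_all add: hop_block_def)
  have "rev v = rev w"
  proof (rule hop_inj)
    \<comment> \<open>For a singleton the tail is empty, and the empty word satisfies
      \<open>hat_word\<close>.\<close>
    show "hat_word (rev v)" using assms(4) c by (auto simp: hat_block_def)
    show "hat_word (rev w)" using assms(7) d by (auto simp: hat_block_def)
  qed (use assms c d eqs in auto)
  then show ?thesis using c d eqs by simp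
qed

lemma hop_block_surj:
  assumes "distinct d" "0 \<notin> set d" "d \<noteq> []" "dumont_block d"
  shows "\<exists>c. distinct c \<and> set c = set d \<and> c \<noteq> [] \<and> hd c = hd d \<and> hat_block c \<and> hop_block c = d"
proof -
  obtain m w where d: "d = m # w" using assms(3) by (cases d) auto
  have "dumont_word w" using assms(4) d by (auto simp: dumont_block_def)
  then obtain v where v: "distinct v" "set v = set w" "hat_word v" "hop v = w"
    using hop_surj[of w] assms(1,2) d by auto
  \<comment> \<open>Singletons correspond to singletons, so the exceptional clauses of the two block
    conditions match.\<close>
  have "tl d = [] \<longleftrightarrow> v = []" using v(2) d by auto
  then show ?thesis
    using v d assms(1,4)
    by (intro exI[of _ "m # rev v"]) (auto simp: hat_block_def dumont_block_def hop_block_def)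
qed

text \<open>Cycles are compared as functions, not as lists, because \<open>shift_cycle\<close> may
  return a rotated list.\<close>

lemma perm_of_cycles_cong:
  "(\<And>c. c \<in> set cs \<Longrightarrow> cycle_of_list (f c) = cycle_of_list (g c)) \<Longrightarrow>
     perm_of_cycles (map f cs) = perm_of_cycles (map g cs)"
  by (induction cs) (auto simp: perm_of_cycles_def)

lemma theta_eq:
  assumes cs: "cs \<in> canonical_cycles A" and eq: "concat cs = one_line (2*n) p"
  shows "theta n p = perm_of_cycles (map hop_block cs)"
proof -
  have "hat_cycles (2*n) p = map flip_block cs"
    unfolding hat_cycles_def Lrmin_eq_lr_minima eq[symmetric] split_at_lr_minima[OF cs] ..
  then have "theta n p = perm_of_cycles (map (\<lambda>c. shift_cycle (flip_block c)) cs)"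
    by (simp add: theta_def o_def)
  also have "\<dots> = perm_of_cycles (map hop_block cs)"
  proof (rule perm_of_cycles_cong)
    fix c assume c: "c \<in> set cs"
    obtain m v where mv: "c = m # v" using canonical_cyclesD(1)[OF cs c] by (cases c) auto
    show "cycle_of_list (shift_cycle (flip_block c)) = cycle_of_list (hop_block c)"
      using cycle_of_list_shift_cycle[of m "rev v"] canonical_cyclesD(2,6)[OF cs c] mv
      by (simp add: hop_block_def)
  qed
  finally show ?thesis .
qed

lemma GI_iff_hat_block:
  assumes cs: "cs \<in> canonical_cycles A" and eq: "concat cs = one_line (2*n) p"
  shows "p \<in> GI n \<longleftrightarrow> p permutes {1..2*n} \<and> (\<forall>c\<in>set cs. hat_block c)"
  unfolding GI_iff eq[symmetric]
  using successively_concat_canonical[of cs] successively_hat_block cs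
  by (auto simp: canonical_cycles_def)

lemma DD_iff_dumont_block:
  assumes cs: "cs \<in> canonical_cycles {1..2*n}"
  shows "perm_of_cycles cs \<in> DD n \<longleftrightarrow> (\<forall>c\<in>set cs. dumont_block c)"
proof -
  let ?s = "perm_of_cycles cs"
  note D = canonical_cyclesD[OF cs]
  have "?s permutes {1..2*n}" using perm_of_cycles_permutes[of cs] D(5) by simp
  then have "?s \<in> DD n \<longleftrightarrow>
      (\<forall>y\<in>set (concat cs). (odd y \<longrightarrow> y \<le> ?s y) \<and> (even y \<longrightarrow> ?s y \<le> y))"
    unfolding DD_iff D(5) by simp
  also have "\<dots> \<longleftrightarrow> (\<forall>c\<in>set cs. \<forall>y\<in>set c. (odd y \<longrightarrow> y \<le> ?s y) \<and> (even y \<longrightarrow> ?s y \<le> y))"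
    by auto
  also have "\<dots> \<longleftrightarrow> (\<forall>c\<in>set cs. \<forall>y\<in>set c.
      (odd y \<longrightarrow> y \<le> cycle_of_list c y) \<and> (even y \<longrightarrow> cycle_of_list c y \<le> y))"
    using perm_of_cycles_eq[OF D(4)] by simp
  also have "\<dots> \<longleftrightarrow> (\<forall>c\<in>set cs. dumont_block c)"
    using dumont_block_iff D(1,2,6) by simp
  finally show ?thesis .
qed

text \<open>The blocks of \<open>p\<close> carry everything: after \<open>hop_block\<close> they are
  the canonical cycle notation of the image.\<close>

lemma GI_canonical:
  assumes "p \<in> GI n"
  obtains cs where "cs \<in> canonical_cycles {1..2*n}" "concat cs = one_line (2*n) p"
    "\<forall>c\<in>set cs. hat_block c" "theta n p = perm_of_cycles (map hop_block cs)"
    "map hop_block cs \<in> canonical_cycles {1..2*n}"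
proof -
  have "p permutes {1..2*n}" using assms by (simp add: GI_def)
  then obtain cs where cs: "cs \<in> canonical_cycles {1..2*n}" "concat cs = one_line (2*n) p"
    using ex_canonical_cycles one_line_permutes by metis
  moreover have "\<forall>c\<in>set cs. hat_block c" using assms GI_iff_hat_block[OF cs] by simp
  moreover have "map hop_block cs \<in> canonical_cycles {1..2*n}"
    using canonical_cyclesD(1,6)[OF cs(1)]
    by (intro canonical_cycles_map[OF cs(1)]) (simp add: hop_block_props)
  ultimately show ?thesis using that theta_eq[OF cs] by blast
qed

theorem theorem4p8:
  fixes n :: nat
  assumes "n \<ge> 1"
  shows "bij_betw (theta n) (GI n) (DD n) \<and>
    (\<forall>p\<in>GI n. Lrmin (2*n) p = Cmin (2*n) (theta n p))"
proof (intro conjI ballI)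
  have zero: "0 \<notin> set c" if "cs \<in> canonical_cycles {1..2*n}" "c \<in> set cs" for cs c
    using canonical_cyclesD(5)[OF that(1)] that(2) by fastforce
  show "bij_betw (theta n) (GI n) (DD n)"
  proof (rule bij_betw_imageI)
    show "inj_on (theta n) (GI n)"
    proof (rule inj_onI)
      fix p q assume p: "p \<in> GI n" and q: "q \<in> GI n" and eq: "theta n p = theta n q"
      from p obtain cs where cs: "cs \<in> canonical_cycles {1..2*n}" "concat cs = one_line (2*n) p"
        "\<forall>c\<in>set cs. hat_block c" "theta n p = perm_of_cycles (map hop_block cs)"
        "map hop_block cs \<in> canonical_cycles {1..2*n}" by (rule GI_canonical)
      from q obtain ds where ds: "ds \<in> canonical_cycles {1..2*n}" "concat ds = one_line (2*n) q"
        "\<forall>c\<in>set ds. hat_block c" "theta n q = perm_of_cycles (map hop_block ds)"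
        "map hop_block ds \<in> canonical_cycles {1..2*n}" by (rule GI_canonical)
      have "map hop_block cs = map hop_block ds"
        using inj_onD[OF perm_of_cycles_inj_on_canonical _ cs(5) ds(5)] cs(4) ds(4) eq by simp
      \<comment> \<open>Cancelling \<open>hop_block\<close> under \<open>map\<close> requires
        injectivity on the blocks of both words together.\<close>
      moreover have "inj_on hop_block (set cs \<union> set ds)"
      proof (rule inj_onI)
        fix c d assume cd: "c \<in> set cs \<union> set ds" "d \<in> set cs \<union> set ds"
          and eq: "hop_block c = hop_block d"
        have "distinct e \<and> 0 \<notin> set e \<and> e \<noteq> [] \<and> hat_block e" if "e \<in> set cs \<union> set ds" for e
          using that zero canonical_cyclesD(1,6)[OF cs(1)] canonical_cyclesD(1,6)[OF ds(1)]
            cs(1,3) ds(1,3) by blast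
        then show "c = d" using hop_block_inj cd eq by blast
      qed
      ultimately have "cs = ds" by (rule map_inj_on)
      then have "one_line (2*n) p = one_line (2*n) q" using cs(2) ds(2) by simp
      then show "p = q"
        using one_line_inj_on p q by (auto simp: GI_def dest: inj_onD)
    qed
  next
    show "theta n ` GI n = DD n"
    proof (intro equalityI subsetI)
      fix s assume "s \<in> theta n ` GI n"
      then obtain p where p: "p \<in> GI n" "s = theta n p" by blast
      from p(1) obtain cs where cs: "cs \<in> canonical_cycles {1..2*n}"
        "concat cs = one_line (2*n) p"
        "\<forall>c\<in>set cs. hat_block c" "theta n p = perm_of_cycles (map hop_block cs)"
        "map hop_block cs \<in> canonical_cycles {1..2*n}" by (rule GI_canonical)
      have "\<forall>c\<in>set cs. dumont_block (hop_block c)"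
        using dumont_block_hop_block zero[OF cs(1)] canonical_cyclesD(6)[OF cs(1)] cs(3) by blast
      then show "s \<in> DD n" using DD_iff_dumont_block[OF cs(5)] cs(4) p(2) by simp
    next
      fix s assume s: "s \<in> DD n"
      then have "s \<in> perm_of_cycles ` canonical_cycles {1..2*n}"
        by (simp add: perm_of_cycles_image_canonical DD_def)
      then obtain ds where ds: "ds \<in> canonical_cycles {1..2*n}" "s = perm_of_cycles ds" by blast
      have "\<forall>d\<in>set ds. \<exists>c. distinct c \<and> set c = set d \<and> c \<noteq> [] \<and> hd c = hd d \<and>
          hat_block c \<and> hop_block c = d"
      proof
        fix d assume d: "d \<in> set ds"
        have "dumont_block d" using DD_iff_dumont_block[OF ds(1)] s ds(2) d by simp
        then show "\<exists>c. distinct c \<and> set c = set d \<and> c \<noteq> [] \<and> hd c = hd d \<and>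
          hat_block c \<and> hop_block c = d"
          using hop_block_surj zero[OF ds(1) d] canonical_cyclesD(1,6)[OF ds(1) d] by blast
      qed
      \<comment> \<open>\<open>g\<close> chooses a preimage block for each cycle of
        \<open>s\<close>; the heads are kept, so the chosen blocks are again canonical and
        concatenate to the one-line notation of some \<open>p\<close>.\<close>
      then obtain g where g: "\<forall>d\<in>set ds. distinct (g d) \<and> set (g d) = set d \<and> g d \<noteq> [] \<and>
          hd (g d) = hd d \<and> hat_block (g d) \<and> hop_block (g d) = d"
        by (rule bchoice[THEN exE])
      have cs: "map g ds \<in> canonical_cycles {1..2*n}"
        using g by (intro canonical_cycles_map[OF ds(1)]) blast
      then have "concat (map g ds) \<in> permutations_of_set {1..2*n}"
        using canonical_cyclesD(4,5)[OF cs] by (intro permutations_of_setI) auto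
      then obtain p where p: "p permutes {1..2*n}" "concat (map g ds) = one_line (2*n) p"
        unfolding one_line_image[symmetric] by blast
      have "map (\<lambda>d. hop_block (g d)) ds = ds" using g by (intro map_idI) blast
      then have "theta n p = s" using theta_eq[OF cs p(2)] ds(2) by (simp add: o_def)
      moreover have "p \<in> GI n" using GI_iff_hat_block[OF cs p(2)] p(1) g by simp
      ultimately show "s \<in> theta n ` GI n" by blast
    qed
  qed
next
  fix p assume "p \<in> GI n"
  then obtain cs where cs: "cs \<in> canonical_cycles {1..2*n}" "concat cs = one_line (2*n) p"
    "\<forall>c\<in>set cs. hat_block c" "theta n p = perm_of_cycles (map hop_block cs)"
    "map hop_block cs \<in> canonical_cycles {1..2*n}" by (rule GI_canonical)
  have "Lrmin (2*n) p = hd ` set cs"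
    using lr_minima_concat[OF cs(1)] cs(2) by (simp add: Lrmin_eq_lr_minima)
  \<comment> \<open>\<open>hop_block\<close> keeps heads, which are the left-to-right minima before
    the map and the cycle minima after it.\<close>
  also have "\<dots> = hd ` set (map hop_block cs)"
    by (simp add: image_image hop_block_def)
  also have "\<dots> = Cmin (2*n) (theta n p)"
    using Cmin_perm_of_cycles[OF cs(5)] cs(4) by simp
  finally show "Lrmin (2*n) p = Cmin (2*n) (theta n p)" .
qed

end
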